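(* Let $l\in\mathbb{N}$ and let $A\subseteq\mathbb{N}$ be a $J$-set in $(\mathbb{N},+)$. Then the set \[ \{(a,b)\in\mathbb{N}\times\mathbb{N}:\ \{a,a+b,a+2b,\ldots,a+lb\}\subseteq A\} \] is a $J$-set in the semigroup $(\mathbb{N}\times\mathbb{N},+)$ (coordinatewise addition).
   Context: $\mathbb{N}=\{1,2,3,\ldots\}$. For a set $X$, $\mathcal{P}_f(X)$ denotes the set of finite nonempty subsets of $X$, and $S^{\mathbb{N}}$ the set of all sequences (functions) $\mathbb{N}\to S$. For a commutative semigroup $(S,+)$, a set $A\subseteq S$ is a $J$-set if for every $F\in\mathcal{P}_f(S^{\mathbb{N}})$ there exist $a\in S$ and $H\in\mathcal{P}_f(\mathbb{N})$ such that $a+\sum_{t\in H}f(t)\in A$ for every $f\in F$. *)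

theory Defs
  imports Main "HOL-Library.FuncSet" "HOL-Library.Product_Plus"
begin

abbreviation pos_nats :: "nat set" where
  "pos_nats \<equiv> {1..}"

definition fin_nonempty_subsets :: "'a set \<Rightarrow> 'a set set" where
  "fin_nonempty_subsets X = {F. F \<subseteq> X \<and> finite F \<and> F \<noteq> {}}"

text \<open>
  A commutative semigroup is given as an addition-closed subset S of an ambient commutative
  monoid. The zero of the monoid need not lie in S. All sums below range over finite nonempty
  index sets, so they are sums in the semigroup S. Sequences in S are indexed by the positive
  integers; as elements of the extensional function space they carry no information at index 0.
\<close>

definition J_set :: "'a::comm_monoid_add set \<Rightarrow> 'a set \<Rightarrow> bool" where
  "J_set S A \<longleftrightarrow> A \<subseteq> S \<and>
     (\<forall>F \<in> fin_nonempty_subsets (pos_nats \<rightarrow>\<^sub>E S).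
        \<exists>a \<in> S. \<exists>H \<in> fin_nonempty_subsets pos_nats.
          \<forall>f \<in> F. a + (\<Sum>t\<in>H. f t) \<in> A)"

lemma sum_in_semigroup:
  fixes f :: "'i \<Rightarrow> 'a::comm_monoid_add"
  assumes "finite H" "H \<noteq> {}" "\<And>t. t \<in> H \<Longrightarrow> f t \<in> S"
    and "\<And>x y. x \<in> S \<Longrightarrow> y \<in> S \<Longrightarrow> x + y \<in> S"
  shows "(\<Sum>t\<in>H. f t) \<in> S"
  using assms by (induction H rule: finite_ne_induct) auto

end

theory Submission
  imports Defs
begin

text \<open>
  Adding the constant \<open>i\<close> to the sequence \<open>t \<mapsto> fst (f t) + i * snd (f t)\<close> makes the sum over \<open>H\<close>
  produce the extra term \<open>i * card H\<close>; hence one application of the J-set property of \<open>A\<close>, with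
  shift \<open>a\<close>, gives the shift \<open>(a, card H)\<close> in the product.
\<close>

theorem theorem9:
  fixes l :: nat and A :: "nat set"
  assumes "l \<ge> 1"
    and "J_set pos_nats A"
  shows "J_set (pos_nats \<times> pos_nats)
           {(a, b) \<in> pos_nats \<times> pos_nats. (\<lambda>i. a + i * b) ` {0..l} \<subseteq> A}"
  unfolding J_set_def
proof (intro conjI ballI)
  fix F :: "(nat \<Rightarrow> nat \<times> nat) set"
  assume "F \<in> fin_nonempty_subsets (pos_nats \<rightarrow>\<^sub>E pos_nats \<times> pos_nats)"
  then have F: "F \<subseteq> pos_nats \<rightarrow>\<^sub>E pos_nats \<times> pos_nats" "finite F" "F \<noteq> {}"
    by (auto simp: fin_nonempty_subsets_def)
  \<comment> \<open>Without the summand \<open>i\<close> the shift would be \<open>(a, 0)\<close>,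
    which lies outside the semigroup. The restricted lambda puts \<open>g f i\<close> into the
    extensional function space.\<close>
  define g :: "(nat \<Rightarrow> nat \<times> nat) \<Rightarrow> nat \<Rightarrow> nat \<Rightarrow> nat"
    where "g f i = (\<lambda>t\<in>pos_nats. fst (f t) + i * snd (f t) + i)" for f i
  have f_pos: "f t \<in> pos_nats \<times> pos_nats" if "f \<in> F" "t \<in> pos_nats" for f t
    using F(1) that by (meson PiE_mem subsetD)
  have "g f i \<in> pos_nats \<rightarrow>\<^sub>E pos_nats" if "f \<in> F" for f i
    using f_pos[OF that] by (force simp: g_def mem_Times_iff)
  \<comment> \<open>All pairs \<open>(f, i)\<close> enter one finite family, so that a single
    \<open>a\<close> and a single \<open>H\<close> serve every \<open>f\<close> and every term of
    its progression.\<close>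
  with F have "(\<lambda>(f, i). g f i) ` (F \<times> {0..l}) \<in> fin_nonempty_subsets (pos_nats \<rightarrow>\<^sub>E pos_nats)"
    unfolding fin_nonempty_subsets_def by auto
  then obtain a H where a: "a \<in> pos_nats" and H: "H \<in> fin_nonempty_subsets pos_nats"
    and *: "\<forall>h \<in> (\<lambda>(f, i). g f i) ` (F \<times> {0..l}). a + (\<Sum>t\<in>H. h t) \<in> A"
    using assms(2) unfolding J_set_def by blast
  have H': "H \<subseteq> pos_nats" "finite H" "H \<noteq> {}"
    using H by (auto simp: fin_nonempty_subsets_def)
  have "(a, card H) + (\<Sum>t\<in>H. f t) \<in> {(a, b) \<in> pos_nats \<times> pos_nats. (\<lambda>i. a + i * b) ` {0..l} \<subseteq> A}"
    if f: "f \<in> F" for f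
  proof -
    \<comment> \<open>The two bracketed sums are the start and the common difference of the
      progression, and its term of index \<open>i\<close> is the value obtained from
      \<open>g f i\<close>.\<close>
    have "(a + (\<Sum>t\<in>H. fst (f t))) + i * (card H + (\<Sum>t\<in>H. snd (f t))) \<in> A" if "i \<in> {0..l}" for i
    proof -
      have "(\<Sum>t\<in>H. g f i t) = (\<Sum>t\<in>H. fst (f t) + i * snd (f t) + i)"
        using H'(1) by (intro sum.cong) (auto simp: g_def)
      then have eq: "a + (\<Sum>t\<in>H. g f i t) =
          (a + (\<Sum>t\<in>H. fst (f t))) + i * (card H + (\<Sum>t\<in>H. snd (f t)))"
        by (simp add: sum.distrib sum_distrib_left algebra_simps)
      have "g f i \<in> (\<lambda>(f, i). g f i) ` (F \<times> {0..l})"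
        using f that by (intro image_eqI[where x = "(f, i)"]) auto
      then have "a + (\<Sum>t\<in>H. g f i t) \<in> A"
        by (rule *[rule_format])
      then show ?thesis
        unfolding eq .
    qed
    moreover have "card H \<ge> 1"
      using H' by (simp add: Suc_le_eq card_gt_0_iff)
    moreover have "(a, card H) + (\<Sum>t\<in>H. f t) =
        (a + (\<Sum>t\<in>H. fst (f t)), card H + (\<Sum>t\<in>H. snd (f t)))"
      by (simp add: prod_eq_iff fst_sum snd_sum)
    ultimately show ?thesis
      using a by (simp add: image_subset_iff)
  qed
  \<comment> \<open>Here \<open>H\<close> being nonempty matters: it makes the second coordinate
    positive.\<close>
  moreover have "(a, card H) \<in> pos_nats \<times> pos_nats"
    using a H' by (simp add: Suc_le_eq card_gt_0_iff)
  ultimately show "\<exists>a \<in> pos_nats \<times> pos_nats. \<exists>H \<in> fin_nonempty_subsets pos_nats. \<forall>f \<in> F.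
      a + (\<Sum>t\<in>H. f t) \<in> {(a, b) \<in> pos_nats \<times> pos_nats. (\<lambda>i. a + i * b) ` {0..l} \<subseteq> A}"
    using H by (intro bexI[where x = "(a, card H)"] bexI[where x = H] ballI)
qed auto

end
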